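(* Let $\Pi_{\mathrm e}$ be a homogeneous Poisson process on $\mathbb{R}^2$ with density $\lambda_{\mathrm e}>0$ and let $g(r)=\frac1{r^{2b}}$ with $b>1$. Then the maximum secrecy rate $\mathcal{R}_{\mathrm s}$ of a legitimate link of deterministic length $r_\ell>0$ in the presence of colluding eavesdroppers at the points of $\Pi_{\mathrm e}$ is a random variable whose cumulative distribution function is $$F_{\mathcal{R}_{\mathrm s}}(\varrho)=\begin{cases}0,&\varrho<0,\\[2pt] 1-F_{\widetilde P_{\mathrm{rx},\mathrm e}}\left(\dfrac{\left(1+\frac{P_\ell}{r_\ell^{2b}\sigma_\ell^2}\right)2^{-\varrho}-1}{(\pi\lambda_{\mathrm e}\mathcal{C}_{1/b}^{-1})^{b}\frac{P_\ell}{\sigma_{\mathrm e}^2}}\right),&0\le\varrho<\mathcal{R}_\ell,\\[2pt] 1,&\varrho\ge\mathcal{R}_\ell,\end{cases}$$ where $\mathcal{R}_\ell=\log_2\left(1+\frac{P_\ell}{r_\ell^{2b}\sigma_\ell^2}\right)$ is the capacity of the legitimate channel; $\mathcal{C}_\alpha=\frac{1-\alpha}{\Gamma(2-\alpha)\cos(\pi\alpha/2)}$; and $F_{\widetilde P_{\mathrm{rx},\mathrm e}}$ is the cumulative distribution function of a skewed stable random variable $\widetilde P_{\mathrm{rx},\mathrm e}\sim\mathcal{S}\left(\alpha=\frac1b,\ \beta=1,\ \gamma=1\right)$.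
   Context: The parameters are the transmit power $P_\ell>0$ and the noise powers $\sigma_\ell^2,\sigma_{\mathrm e}^2>0$. With $R_{\mathrm e,1}\le R_{\mathrm e,2}\le\cdots$ the distances from the origin (the transmitter) to the points of $\Pi_{\mathrm e}$, the maximum secrecy rate with colluding eavesdroppers is $$\mathcal{R}_{\mathrm s}=\left[\log_{2}\left(1+\frac{P_\ell\, g(r_\ell)}{\sigma_\ell^2}\right)-\log_{2}\left(1+\frac{P_\ell\sum_{i=1}^{\infty}g(R_{\mathrm e,i})}{\sigma_{\mathrm e}^2}\right)\right]^{+},\qquad [t]^+=\max\{t,0\}.$$ $\mathcal{S}(\alpha,\beta,\gamma)$ denotes the real stable distribution with characteristic exponent $\alpha\in(0,2]$, skewness $\beta\in[-1,1]$, dispersion $\gamma\ge0$, having characteristic function $\phi(w)=\mathbb{E}\{e^{jwX}\}$ equal, for $\alpha\ne1$, to $\exp\left(-\gamma|w|^{\alpha}\left[1-j\beta\,\mathrm{sign}(w)\tan\left(\frac{\pi\alpha}{2}\right)\right]\right)$ ($j$ the imaginary unit). $\Gamma$ is the gamma function. *)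

theory Defs
  imports "HOL-Probability.Probability"
begin

section \<open>Homogeneous Poisson processes in the plane\<close>

text \<open>
  A point process is modelled as a random locally finite set of points.  The Poisson law of the
  counts is written out because the library's \<open>poisson_pmf\<close> needs a positive rate, which
  would exclude Lebesgue-null sets.  In \<open>count_indep\<close> the family of sets is indexed by
  itself.
\<close>

locale homogeneous_poisson_process = prob_space M
  for M :: "'w measure" and Eve :: "'w \<Rightarrow> (real ^ 2) set" and lam :: real +
  assumes locally_finite:
      "\<And>\<omega> B. \<omega> \<in> space M \<Longrightarrow> bounded B \<Longrightarrow> finite (Eve \<omega> \<inter> B)"
    and count_measurable:
      "\<And>B. B \<in> sets borel \<Longrightarrow> bounded B \<Longrightarrow>
         (\<lambda>\<omega>. card (Eve \<omega> \<inter> B)) \<in> measurable M (count_space UNIV)"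
    and count_poisson:
      "\<And>B k. B \<in> sets borel \<Longrightarrow> bounded B \<Longrightarrow>
         prob {\<omega> \<in> space M. card (Eve \<omega> \<inter> B) = k} =
           (lam * measure lborel B) ^ k / fact k * exp (- (lam * measure lborel B))"
    and count_indep:
      "\<And>\<B>. finite \<B> \<Longrightarrow> disjoint \<B> \<Longrightarrow>
         (\<And>B. B \<in> \<B> \<Longrightarrow> B \<in> sets borel \<and> bounded B) \<Longrightarrow>
         indep_vars (\<lambda>_. count_space UNIV) (\<lambda>B \<omega>. card (Eve \<omega> \<inter> B)) \<B>"

text \<open>
  The \<open>i\<close>-th smallest distance from the origin to the points of a locally finite set, counted
  with multiplicity and with indices starting at \<open>0\<close>, so that \<open>ordered_dist S i\<close> is the
  distance usually written \<open>R\<close> with index \<open>i + 1\<close>.  It is meaningful when \<open>S\<close> has more than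
  \<open>i\<close> points; a homogeneous Poisson process of positive density almost surely has infinitely many.
\<close>

definition ordered_dist :: "(real ^ 2) set \<Rightarrow> nat \<Rightarrow> real" where
  "ordered_dist S i = Inf {r. 0 \<le> r \<and> i < card (S \<inter> cball 0 r)}"


section \<open>Secrecy rate with colluding eavesdroppers\<close>

text \<open>
  Arguments: transmit power \<open>P\<close>, noise powers \<open>sl2\<close> (legitimate receiver) and \<open>se2\<close>
  (eavesdroppers), power gain \<open>g\<close>, length \<open>rl\<close> of the legitimate link, and the set \<open>S\<close> of
  eavesdropper positions.  The series is a real one, so it is meaningful only where it converges;
  for the Poisson process and the gain below with \<open>b > 1\<close> this holds almost surely.
\<close>

definition secrecy_rate ::
  "real \<Rightarrow> real \<Rightarrow> real \<Rightarrow> (real \<Rightarrow> real) \<Rightarrow> real \<Rightarrow> (real ^ 2) set \<Rightarrow> real" where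
  "secrecy_rate P sl2 se2 g rl S =
     max (log 2 (1 + P * g rl / sl2)
          - log 2 (1 + P * (\<Sum>i. g (ordered_dist S i)) / se2)) 0"

definition path_gain :: "real \<Rightarrow> real \<Rightarrow> real" where
  "path_gain b r = 1 / r powr (2 * b)"

definition legit_capacity :: "real \<Rightarrow> real \<Rightarrow> real \<Rightarrow> real \<Rightarrow> real" where
  "legit_capacity P sl2 b rl = log 2 (1 + P / (rl powr (2 * b) * sl2))"


section \<open>Stable distributions\<close>

text \<open>
  Only the exponents different from \<open>1\<close> are covered; the characteristic function has another form
  for exponent \<open>1\<close>.
\<close>

definition is_stable :: "real \<Rightarrow> real \<Rightarrow> real \<Rightarrow> real measure \<Rightarrow> bool" where
  "is_stable \<alpha> \<beta> \<gamma> \<mu> \<longleftrightarrow>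
     0 < \<alpha> \<and> \<alpha> \<le> 2 \<and> \<alpha> \<noteq> 1 \<and> - 1 \<le> \<beta> \<and> \<beta> \<le> 1 \<and> 0 \<le> \<gamma> \<and>
     real_distribution \<mu> \<and>
     (\<forall>w. char \<mu> w =
        exp (- complex_of_real (\<gamma> * \<bar>w\<bar> powr \<alpha>)
              * (1 - \<i> * complex_of_real (\<beta> * sgn w * tan (pi * \<alpha> / 2)))))"

definition stable_measure :: "real \<Rightarrow> real \<Rightarrow> real \<Rightarrow> real measure" where
  "stable_measure \<alpha> \<beta> \<gamma> = (THE \<mu>. is_stable \<alpha> \<beta> \<gamma> \<mu>)"

lemma is_stable_unique:
  assumes "is_stable \<alpha> \<beta> \<gamma> \<mu>" "is_stable \<alpha> \<beta> \<gamma> \<nu>"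
  shows "\<mu> = \<nu>"
  using assms by (intro Levy_uniqueness) (auto simp: is_stable_def fun_eq_iff)

lemma stable_measure_eq: "is_stable \<alpha> \<beta> \<gamma> \<mu> \<Longrightarrow> stable_measure \<alpha> \<beta> \<gamma> = \<mu>"
  unfolding stable_measure_def using is_stable_unique by blast

definition stable_const :: "real \<Rightarrow> real" where
  "stable_const \<alpha> = (1 - \<alpha>) / (Gamma (2 - \<alpha>) * cos (pi * \<alpha> / 2))"

end

theory Submission
  imports
    Defs
    "HOL-Real_Asymp.Real_Asymp"
    "HOL-Complex_Analysis.Complex_Analysis"
begin

text \<open>
  Let \<open>Z\<close> be the sum of \<open>|x| powr (- 2 b)\<close> over the eavesdroppers \<open>x\<close>.  Independence of the
  Poisson counts gives the Laplace functional of the process on step functions, and monotone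
  convergence extends it to all nonnegative functions.  Hence \<open>Z\<close> has Laplace transform
  \<open>exp (- c * s powr (1 / b))\<close> with \<open>c = \<pi> * lam * \<Gamma> (1 - 1 / b)\<close>; in particular \<open>Z\<close> is
  almost surely finite.  Both sides are analytic on the right half-plane, so they agree there, and
  on its boundary this is the characteristic function of a totally skewed stable law.  The event
  \<open>Rs \<le> \<rho>\<close> says that \<open>Z\<close> is at least a threshold; stable laws have no atoms, so its probability is
  one minus the distribution function at the threshold.
\<close>

section \<open>The Laplace functional of the Poisson process\<close>

text \<open>The map \<open>exp (- x)\<close> extended continuously to \<open>x = \<top>\<close>. The
  case split is essential: \<open>enn2real \<top>\<close> is 0, which would give the value 1 there
  instead of 0. Real values between 0 and 1 make every expectation below well defined even when the
  exponent is infinite.\<close>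

definition nexp :: "ennreal \<Rightarrow> real" where
  "nexp x = (if x = \<top> then 0 else exp (- enn2real x))"

lemma nexp_ennreal [simp]: "0 \<le> r \<Longrightarrow> nexp (ennreal r) = exp (- r)"
  by (simp add: nexp_def)

lemma nexp_top [simp]: "nexp \<top> = 0"
  by (simp add: nexp_def)

lemma nexp_nonneg [simp]: "0 \<le> nexp x" and nexp_le_1 [simp]: "nexp x \<le> 1"
  by (auto simp: nexp_def)

lemma nexp_eq_0_iff [simp]: "nexp x = 0 \<longleftrightarrow> x = \<top>"
  by (auto simp: nexp_def)

lemma borel_measurable_nexp [measurable]: "nexp \<in> borel_measurable borel"
  unfolding nexp_def[abs_def] by measurable

lemma tendsto_nexp:
  assumes "(X \<longlongrightarrow> L) F"
  shows "((\<lambda>n. nexp (X n)) \<longlongrightarrow> nexp L) F"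
proof (cases "L = \<top>")
  case False
  have ev: "eventually (\<lambda>n. X n < \<top>) F"
    using order_tendstoD(2)[OF assms, of \<top>] False by (simp add: less_top)
  have "((\<lambda>n. exp (- enn2real (X n))) \<longlongrightarrow> exp (- enn2real L)) F"
    by (intro tendsto_intros tendsto_enn2real) (use assms False in \<open>auto simp: less_top\<close>)
  then show ?thesis
    using False ev by (subst tendsto_cong[where g = "\<lambda>n. exp (- enn2real (X n))"])
      (auto simp: nexp_def elim!: eventually_mono)
next
  case True
  show ?thesis
  proof (rule order_tendstoI)
    fix a assume "a < nexp L"
    then have "a < 0" using True by simp
    then show "eventually (\<lambda>n. a < nexp (X n)) F"
      by (intro always_eventually allI) (rule less_le_trans[OF _ nexp_nonneg])
  next
    fix e assume "nexp L < e"
    then have e: "0 < e" using True by simp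
    \<comment> \<open>\<open>exp (- r) < e\<close> holds exactly for \<open>r > - ln e\<close>. The
      maximum with 0 keeps \<open>ennreal K\<close> from truncating a negative bound.\<close>
    define K where "K = max 0 (- ln e)"
    have "eventually (\<lambda>n. ennreal K < X n) F"
      using order_tendstoD(1)[OF assms, of "ennreal K"] True by simp
    then show "eventually (\<lambda>n. nexp (X n) < e) F"
    proof eventually_elim
      case (elim n)
      show ?case
      proof (cases "X n")
        case (real r)
        have "0 \<le> K" by (simp add: K_def)
        then have "K < r" using elim real by (simp add: ennreal_less_iff)
        then have "- r < ln e" unfolding K_def by auto
        then have "exp (- r) < e" using e by (metis exp_less_mono exp_ln)
        then show ?thesis using real by simp
      qed (use e in simp)
    qed
  qed
qed

text \<open>Integration over level sets. With \<open>h 0 = 0\<close> the level set of 0, typically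
  of infinite measure, drops out. Asking only that level sets be measurable lets the lemma serve
  both the counting measure on the points and Lebesgue measure.\<close>

lemma nn_integral_finite_range:
  fixes F :: "'a \<Rightarrow> real" and h :: "real \<Rightarrow> real"
  assumes fin: "finite (F ` UNIV)" and h0: "h 0 = 0" and hn: "\<And>x. 0 \<le> x \<Longrightarrow> 0 \<le> h x"
    and Fn: "\<And>x. 0 \<le> F x"
    and meas: "\<And>y. F -` {y} \<inter> space \<mu> \<in> sets \<mu>"
  shows "(\<integral>\<^sup>+x. ennreal (h (F x)) \<partial>\<mu>) =
    (\<Sum>y\<in>F ` UNIV - {0}. ennreal (h y) * emeasure \<mu> (F -` {y} \<inter> space \<mu>))"
proof -
  let ?Y = "F ` UNIV - {0}"
  have eq: "ennreal (h (F x)) = (\<Sum>y\<in>?Y. ennreal (h y) * indicator (F -` {y} \<inter> space \<mu>) x)"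
    if "x \<in> space \<mu>" for x
  proof -
    have "(\<Sum>y\<in>?Y. ennreal (h y) * indicator (F -` {y} \<inter> space \<mu>) x)
        = (\<Sum>y\<in>?Y. if y = F x then ennreal (h y) else 0)"
      using that by (intro sum.cong) (auto simp: indicator_def)
    also have "\<dots> = ennreal (h (F x))"
      using fin h0 by (simp add: sum.delta')
    finally show ?thesis ..
  qed
  have "(\<integral>\<^sup>+x. ennreal (h (F x)) \<partial>\<mu>) =
      (\<integral>\<^sup>+x. (\<Sum>y\<in>?Y. ennreal (h y) * indicator (F -` {y} \<inter> space \<mu>) x) \<partial>\<mu>)"
    by (intro nn_integral_cong eq)
  also have "\<dots> = (\<Sum>y\<in>?Y. \<integral>\<^sup>+x. ennreal (h y) * indicator (F -` {y} \<inter> space \<mu>) x \<partial>\<mu>)"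
    using meas by (intro nn_integral_sum) auto
  also have "\<dots> = (\<Sum>y\<in>?Y. ennreal (h y) * emeasure \<mu> (F -` {y} \<inter> space \<mu>))"
    using meas by (intro sum.cong refl nn_integral_cmult_indicator)
  finally show ?thesis .
qed

section \<open>Laplace transforms of the counts and of sums over the points\<close>

context homogeneous_poisson_process
begin

text \<open>The Laplace transform of a Poisson variable: splitting by the value of the count leaves
  \<open>exp (- p)\<close> times the exponential series of \<open>p * exp (- y)\<close>. The
  nonnegative integral allows sum and integral to be exchanged freely.\<close>

lemma expectation_exp_count:
  assumes B: "B \<in> sets borel" "bounded B" and lam: "0 \<le> lam"
  shows "expectation (\<lambda>\<omega>. exp (- y * real (card (Eve \<omega> \<inter> B)))) =
    exp (- (lam * measure lborel B * (1 - exp (- y))))"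
proof -
  let ?N = "\<lambda>\<omega>. card (Eve \<omega> \<inter> B)"
  define p where "p = lam * measure lborel B"
  have p: "0 \<le> p" using lam by (simp add: p_def)
  have N[measurable]: "?N \<in> measurable M (count_space UNIV)"
    using count_measurable[OF B] .
  let ?A = "\<lambda>k. {\<omega> \<in> space M. ?N \<omega> = k}"
  have A: "?A k \<in> sets M" for k by measurable
  have sm: "(\<lambda>k. exp (- y * real k) * (p ^ k / fact k * exp (- p))) sums
      (exp (- p) * exp (p * exp (- y)))"
  proof -
    have "(\<lambda>k. exp (- p) * ((p * exp (- y)) ^ k /\<^sub>R fact k)) sums (exp (- p) * exp (p * exp (- y)))"
      by (intro sums_mult exp_converges)
    then show ?thesis
      by (rule sums_cong[THEN iffD1, rotated])
        (simp add: power_mult_distrib exp_of_nat_mult[symmetric] field_simps)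
  qed
  have "(\<integral>\<^sup>+\<omega>. ennreal (exp (- y * real (?N \<omega>))) \<partial>M) =
      (\<integral>\<^sup>+\<omega>. (\<Sum>k. ennreal (exp (- y * real k)) * indicator (?A k) \<omega>) \<partial>M)"
  proof (intro nn_integral_cong)
    fix \<omega> assume w: "\<omega> \<in> space M"
    have "(\<Sum>k. ennreal (exp (- y * real k)) * indicator (?A k) \<omega>) =
        (\<Sum>k\<in>{?N \<omega>}. ennreal (exp (- y * real k)) * indicator (?A k) \<omega>)"
      by (intro suminf_finite) (auto simp: indicator_def)
    then show "ennreal (exp (- y * real (?N \<omega>))) = (\<Sum>k. ennreal (exp (- y * real k)) * indicator (?A k) \<omega>)"
      using w by simp
  qed
  also have "\<dots> = (\<Sum>k. \<integral>\<^sup>+\<omega>. ennreal (exp (- y * real k)) * indicator (?A k) \<omega> \<partial>M)"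
    by (intro nn_integral_suminf) measurable
  also have "\<dots> = (\<Sum>k. ennreal (exp (- y * real k) * (p ^ k / fact k * exp (- p))))"
    using p by (intro suminf_cong)
      (subst nn_integral_cmult_indicator[OF A],
       simp add: emeasure_eq_measure count_poisson[OF B] p_def[symmetric] flip: ennreal_mult)
  also have "\<dots> = ennreal (exp (- p) * exp (p * exp (- y)))"
    using sm p by (intro suminf_ennreal_eq) auto
  finally have "(\<integral>\<^sup>+\<omega>. ennreal (exp (- y * real (?N \<omega>))) \<partial>M) = ennreal (exp (- p) * exp (p * exp (- y)))" .
  then have "expectation (\<lambda>\<omega>. exp (- y * real (?N \<omega>))) = exp (- p) * exp (p * exp (- y))"
    by (intro integral_eq_nn_integral[THEN trans]) auto
  also have "\<dots> = exp (- (p * (1 - exp (- y))))"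
    by (simp add: exp_add[symmetric] algebra_simps)
  finally show ?thesis by (simp add: p_def)
qed

text \<open>For a step function the sum over the points is a linear combination of counts on
  disjoint level sets. These counts are independent, so the expectation factors into Poisson
  transforms. Bounded support makes the level sets of nonzero values bounded, as the axioms on
  counts require.\<close>

lemma
  fixes F :: "real ^ 2 \<Rightarrow> real"
  assumes lam: "0 \<le> lam" and fin: "finite (F ` UNIV)" and Fn: "\<And>x. 0 \<le> F x"
    and F[measurable]: "F \<in> borel_measurable borel"
    and supp: "bounded {x. F x \<noteq> 0}"
  shows Laplace_functional_step:
      "expectation (\<lambda>\<omega>. nexp (\<integral>\<^sup>+x. ennreal (F x) \<partial>count_space (Eve \<omega>))) =
        nexp (ennreal lam * (\<integral>\<^sup>+x. ennreal (1 - exp (- F x)) \<partial>lborel))" (is ?T1)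
    and measurable_count_integral_step:
      "(\<lambda>\<omega>. \<integral>\<^sup>+x. ennreal (F x) \<partial>count_space (Eve \<omega>)) \<in> borel_measurable M" (is ?T2)
proof -
  let ?Y = "F ` UNIV - {0}" and ?B = "\<lambda>y. F -` {y}"
  have Yn: "0 \<le> y" if "y \<in> ?Y" for y using that Fn by auto
  have finY: "finite ?Y" using fin by simp
  have B: "?B y \<in> sets borel" for y
    using measurable_sets[OF F, of "{y}"] by simp
  have bB: "bounded (?B y)" if "y \<in> ?Y" for y
    by (rule bounded_subset[OF supp]) (use that in auto)
  have N[measurable]: "(\<lambda>\<omega>. card (Eve \<omega> \<inter> ?B y)) \<in> measurable M (count_space UNIV)" if "y \<in> ?Y" for y
    using count_measurable[OF B bB[OF that]] .
  have X: "(\<integral>\<^sup>+x. ennreal (F x) \<partial>count_space (Eve \<omega>)) =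
      ennreal (\<Sum>y\<in>?Y. y * real (card (Eve \<omega> \<inter> ?B y)))" if "\<omega> \<in> space M" for \<omega>
  proof -
    have "(\<integral>\<^sup>+x. ennreal (F x) \<partial>count_space (Eve \<omega>)) =
        (\<Sum>y\<in>?Y. ennreal y * emeasure (count_space (Eve \<omega>)) (?B y \<inter> Eve \<omega>))"
      using nn_integral_finite_range[OF fin, of "\<lambda>x. x" "count_space (Eve \<omega>)"] Fn by simp
    also have "\<dots> = (\<Sum>y\<in>?Y. ennreal (y * real (card (Eve \<omega> \<inter> ?B y))))"
    proof (intro sum.cong refl)
      fix y assume y: "y \<in> ?Y"
      have "finite (Eve \<omega> \<inter> ?B y)" using locally_finite[OF that bB[OF y]] .
      then show "ennreal y * emeasure (count_space (Eve \<omega>)) (?B y \<inter> Eve \<omega>) =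
          ennreal (y * real (card (Eve \<omega> \<inter> ?B y)))"
        using Yn[OF y] by (simp add: Int_commute ennreal_mult ennreal_of_nat_eq_real_of_nat)
    qed
    also have "\<dots> = ennreal (\<Sum>y\<in>?Y. y * real (card (Eve \<omega> \<inter> ?B y)))"
      using Yn by (intro sum_ennreal) auto
    finally show ?thesis .
  qed
  have "(\<lambda>\<omega>. ennreal (\<Sum>y\<in>?Y. y * real (card (Eve \<omega> \<inter> ?B y)))) \<in> borel_measurable M"
  proof -
    have "(\<lambda>\<omega>. y * real (card (Eve \<omega> \<inter> ?B y))) \<in> borel_measurable M" if "y \<in> ?Y" for y
      using N[OF that] by measurable
    then show ?thesis by (intro measurable_compose[OF borel_measurable_sum]) auto
  qed
  then show ?T2
    by (subst measurable_cong[OF X])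
  have inj: "inj_on ?B ?Y"
    by (auto simp: inj_on_def)
  \<comment> \<open>\<open>count_indep\<close> indexes the sets by themselves, so the weight
    \<open>y\<close> has to be recovered from its level set. Level sets of distinct attained values
    are distinct, hence \<open>v\<close> is a true inverse.\<close>
  define v where "v = inv_into ?Y ?B"
  have v: "v (?B y) = y" if "y \<in> ?Y" for y
    unfolding v_def using inv_into_f_f[OF inj that] .
  have reindex: "(\<Prod>B\<in>?B ` ?Y. h (v B) B) = (\<Prod>y\<in>?Y. h y (?B y))"
    for h :: "real \<Rightarrow> (real ^ 2) set \<Rightarrow> real"
    unfolding prod.reindex[OF inj] comp_def by (intro prod.cong refl) (simp only: v)
  have "indep_vars (\<lambda>_. count_space UNIV) (\<lambda>B \<omega>. card (Eve \<omega> \<inter> B)) (?B ` ?Y)"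
    using finY B bB by (intro count_indep) (auto simp: disjoint_def)
  then have ind: "indep_vars (\<lambda>_. borel)
      (\<lambda>B \<omega>. exp (- v B * real (card (Eve \<omega> \<inter> B)))) (?B ` ?Y)"
    by (rule indep_vars_compose2) simp
  have "expectation (\<lambda>\<omega>. nexp (\<integral>\<^sup>+x. ennreal (F x) \<partial>count_space (Eve \<omega>))) =
      expectation (\<lambda>\<omega>. \<Prod>y\<in>?Y. exp (- y * real (card (Eve \<omega> \<inter> ?B y))))"
  proof (intro Bochner_Integration.integral_cong refl)
    fix \<omega> assume w: "\<omega> \<in> space M"
    have "0 \<le> (\<Sum>y\<in>?Y. y * real (card (Eve \<omega> \<inter> ?B y)))"
      using Yn by (intro sum_nonneg mult_nonneg_nonneg) auto
    then show "nexp (\<integral>\<^sup>+x. ennreal (F x) \<partial>count_space (Eve \<omega>)) =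
        (\<Prod>y\<in>?Y. exp (- y * real (card (Eve \<omega> \<inter> ?B y))))"
      by (simp only: X[OF w] nexp_ennreal) (simp add: exp_sum[OF finY, symmetric] sum_negf)
  qed
  also have "\<dots> = expectation (\<lambda>\<omega>. \<Prod>B\<in>?B ` ?Y. exp (- v B * real (card (Eve \<omega> \<inter> B))))"
    by (simp only: reindex[of "\<lambda>y B. exp (- y * real (card (Eve _ \<inter> B)))"])
  also have "\<dots> = (\<Prod>B\<in>?B ` ?Y. expectation (\<lambda>\<omega>. exp (- v B * real (card (Eve \<omega> \<inter> B)))))"
  proof (rule indep_vars_lebesgue_integral[OF _ ind])
    show "finite (?B ` ?Y)" using finY by simp
    fix B assume "B \<in> ?B ` ?Y"
    then obtain y where y: "y \<in> ?Y" "B = ?B y" by blast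
    then have "v B = y" using v by simp
    then show "integrable M (\<lambda>\<omega>. exp (- v B * real (card (Eve \<omega> \<inter> B))))"
      using N[OF y(1)] Yn[OF y(1)] y(2) by (intro integrable_const_bound[where B = 1]) auto
  qed
  also have "\<dots> = (\<Prod>y\<in>?Y. expectation (\<lambda>\<omega>. exp (- y * real (card (Eve \<omega> \<inter> ?B y)))))"
    by (simp only: reindex[of "\<lambda>y B. expectation (\<lambda>\<omega>. exp (- y * real (card (Eve \<omega> \<inter> B))))"])
  also have "\<dots> = (\<Prod>y\<in>?Y. exp (- (lam * measure lborel (?B y) * (1 - exp (- y)))))"
    using B bB lam by (intro prod.cong refl expectation_exp_count) auto
  also have "\<dots> = exp (- (lam * (\<Sum>y\<in>?Y. (1 - exp (- y)) * measure lborel (?B y))))"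
    by (simp add: exp_sum[OF finY, symmetric] sum_negf sum_distrib_left mult_ac)
  also have "\<dots> = nexp (ennreal (lam * (\<Sum>y\<in>?Y. (1 - exp (- y)) * measure lborel (?B y))))"
    using lam Yn by (intro nexp_ennreal[symmetric] mult_nonneg_nonneg sum_nonneg) auto
  also have "ennreal (lam * (\<Sum>y\<in>?Y. (1 - exp (- y)) * measure lborel (?B y))) =
      ennreal lam * (\<Sum>y\<in>?Y. ennreal (1 - exp (- y)) * emeasure lborel (?B y))"
  proof -
    have "ennreal (1 - exp (- y)) * emeasure lborel (?B y) =
        ennreal ((1 - exp (- y)) * measure lborel (?B y))" if "y \<in> ?Y" for y
      using Yn[OF that] emeasure_bounded_finite[OF bB[OF that]]
      by (simp add: emeasure_eq_ennreal_measure ennreal_mult)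
    then have "(\<Sum>y\<in>?Y. ennreal (1 - exp (- y)) * emeasure lborel (?B y)) =
        (\<Sum>y\<in>?Y. ennreal ((1 - exp (- y)) * measure lborel (?B y)))"
      by (intro sum.cong refl)
    also have "\<dots> = ennreal (\<Sum>y\<in>?Y. (1 - exp (- y)) * measure lborel (?B y))"
      using Yn by (intro sum_ennreal mult_nonneg_nonneg) auto
    finally show ?thesis
      using lam by (simp only: ennreal_mult')
  qed
  also have "(\<Sum>y\<in>?Y. ennreal (1 - exp (- y)) * emeasure lborel (?B y)) =
      (\<integral>\<^sup>+x. ennreal (1 - exp (- F x)) \<partial>lborel)"
    using nn_integral_finite_range[OF fin, of "\<lambda>y. 1 - exp (- y)" lborel] Fn B by simp
  finally show ?T1 .
qed

text \<open>Both sides pass to the limit along step functions increasing to \<open>f\<close>: the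
  exponents by monotone convergence, \<open>nexp\<close> by continuity (also at
  \<open>\<top>\<close>), and the expectation by domination by 1. No integrability of
  \<open>f\<close> is involved.\<close>

lemma
  fixes f :: "real ^ 2 \<Rightarrow> real"
  assumes lam: "0 \<le> lam" and fn: "\<And>x. 0 \<le> f x" and f[measurable]: "f \<in> borel_measurable borel"
  shows Laplace_functional:
      "expectation (\<lambda>\<omega>. nexp (\<integral>\<^sup>+x. ennreal (f x) \<partial>count_space (Eve \<omega>))) =
        nexp (ennreal lam * (\<integral>\<^sup>+x. ennreal (1 - exp (- f x)) \<partial>lborel))" (is ?T1)
    and measurable_count_integral:
      "(\<lambda>\<omega>. \<integral>\<^sup>+x. ennreal (f x) \<partial>count_space (Eve \<omega>)) \<in> borel_measurable M" (is ?T2)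
proof -
  obtain G where G: "\<And>i. simple_function borel (G i)" "incseq G"
      "\<And>x. bdd_above (range (\<lambda>i. G i x))" "\<And>i x. 0 \<le> G i x" "f = (SUP i. G i)"
    using borel_measurable_implies_simple_function_sequence_real[OF f fn] by blast
  \<comment> \<open>Cutting off by growing balls gives bounded support. Since \<open>G i\<close> is
    nonnegative, the sequence stays increasing, and at each point it eventually equals
    \<open>G i\<close>.\<close>
  define F where "F i x = G i x * indicator (cball 0 (real i)) x" for i x
  have Gf: "(\<lambda>i. G i x) \<longlonglongrightarrow> f x" for x
    using LIMSEQ_incseq_SUP[OF G(3), of x] G(2) by (simp add: G(5) incseq_def le_fun_def image_image)
  have Fn: "0 \<le> F i x" for i x using G(4) by (simp add: F_def)
  have [measurable]: "G i \<in> borel_measurable borel" for i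
    using G(1) by (rule borel_measurable_simple_function)
  have Fm[measurable]: "F i \<in> borel_measurable borel" for i
    unfolding F_def[abs_def] by (intro borel_measurable_times borel_measurable_indicator) simp_all
  have fin: "finite (F i ` UNIV)" for i
  proof (rule finite_subset)
    show "F i ` UNIV \<subseteq> insert 0 (G i ` UNIV)" by (auto simp: F_def indicator_def)
    show "finite (insert 0 (G i ` UNIV))" using G(1)[of i] by (simp add: simple_function_def)
  qed
  have supp: "bounded {x. F i x \<noteq> 0}" for i
    by (rule bounded_subset[OF bounded_cball[of 0 "real i"]]) (auto simp: F_def indicator_def split: if_splits)
  have mono: "F i x \<le> F j x" if "i \<le> j" for i j x
    using that G(2,4) unfolding F_def
    by (intro mult_mono) (auto simp: incseq_def le_fun_def indicator_def)
  have lim: "(\<lambda>i. F i x) \<longlonglongrightarrow> f x" for x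
  proof -
    obtain n :: nat where n: "norm x \<le> real n" using real_arch_simple by blast
    have "eventually (\<lambda>i. F i x = G i x) sequentially"
      using eventually_ge_at_top[of n] by eventually_elim (use n in \<open>auto simp: F_def indicator_def\<close>)
    then show ?thesis using Gf[of x] by (subst tendsto_cong)
  qed
  have X: "(\<lambda>i. \<integral>\<^sup>+x. ennreal (F i x) \<partial>\<mu>) \<longlonglongrightarrow> (\<integral>\<^sup>+x. ennreal (f x) \<partial>\<mu>)"
    if "\<And>i. F i \<in> borel_measurable \<mu>" for \<mu>
  proof (rule nn_integral_LIMSEQ)
    show "incseq (\<lambda>i x. ennreal (F i x))"
      by (auto simp: incseq_def le_fun_def intro!: ennreal_leI mono)
  qed (use lim that in auto)
  have R: "(\<lambda>i. \<integral>\<^sup>+x. ennreal (1 - exp (- F i x)) \<partial>lborel) \<longlonglongrightarrow>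
      (\<integral>\<^sup>+x. ennreal (1 - exp (- f x)) \<partial>lborel)"
  proof (rule nn_integral_LIMSEQ)
    show "incseq (\<lambda>i x. ennreal (1 - exp (- F i x)))"
      by (auto simp: incseq_def le_fun_def intro!: ennreal_leI mono)
    show "(\<lambda>i. ennreal (1 - exp (- F i x))) \<longlonglongrightarrow> ennreal (1 - exp (- f x))" for x
      by (intro tendsto_intros lim)
  qed auto
  note meas = measurable_count_integral_step[OF lam fin Fn Fm supp]
  show T2: ?T2
    by (rule borel_measurable_LIMSEQ_order[OF X meas]) simp
  have "(\<lambda>i. expectation (\<lambda>\<omega>. nexp (\<integral>\<^sup>+x. ennreal (F i x) \<partial>count_space (Eve \<omega>)))) \<longlonglongrightarrow>
      expectation (\<lambda>\<omega>. nexp (\<integral>\<^sup>+x. ennreal (f x) \<partial>count_space (Eve \<omega>)))"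
    using meas T2 by (intro integral_dominated_convergence[where w = "\<lambda>_. 1"]) (auto intro!: tendsto_nexp X)
  moreover have "(\<lambda>i. nexp (ennreal lam * (\<integral>\<^sup>+x. ennreal (1 - exp (- F i x)) \<partial>lborel))) \<longlonglongrightarrow>
      nexp (ennreal lam * (\<integral>\<^sup>+x. ennreal (1 - exp (- f x)) \<partial>lborel))"
    by (intro tendsto_nexp ennreal_tendsto_cmult R) simp
  ultimately show ?T1
    unfolding Laplace_functional_step[OF lam fin Fn Fm supp] by (rule LIMSEQ_unique)
qed

end

section \<open>From Laplace transforms to stable laws\<close>

text \<open>Differentiation under the expectation. Near \<open>z\<close> the difference quotients
  are dominated by a constant, through the mean value inequality on a convex half-plane that stays
  away from the imaginary axis.\<close>

lemma (in prob_space) holomorphic_Laplace_transform: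
  assumes X[measurable]: "X \<in> borel_measurable M" and Xn: "\<And>\<omega>. \<omega> \<in> space M \<Longrightarrow> 0 \<le> X \<omega>"
  shows "(\<lambda>z. expectation (\<lambda>\<omega>. exp (- z * complex_of_real (X \<omega>)))) holomorphic_on {z. 0 < Re z}"
proof -
  let ?L = "\<lambda>z. expectation (\<lambda>\<omega>. exp (- z * complex_of_real (X \<omega>)))"
  have int: "integrable M (\<lambda>\<omega>. exp (- z * complex_of_real (X \<omega>)))" if "0 < Re z" for z
    using that Xn by (intro integrable_const_bound[where B = 1]) auto
  have "(?L has_field_derivative expectation (\<lambda>\<omega>. - of_real (X \<omega>) * exp (- z * of_real (X \<omega>)))) (at z)"
    if z: "0 < Re z" for z
  proof -
    define e where "e = Re z / 2"
    define S where "S = {w. e < Re w}"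
    have e: "0 < e" using z by (simp add: e_def)
    have oS: "open S" unfolding S_def by (rule open_halfspace_Re_gt)
    have cS: "convex S" unfolding S_def by (rule convex_halfspace_Re_gt)
    have zS: "z \<in> S" using z by (simp add: S_def e_def)
    have deriv: "((\<lambda>w. exp (- w * complex_of_real x)) has_field_derivative
        - of_real x * exp (- w * of_real x)) (at w within T)" for w x T
      by (auto intro!: derivative_eq_intros)
    \<comment> \<open>From \<open>e * x \<le> exp (e * x)\<close>, the product
      \<open>x * exp (- e * x)\<close> is at most \<open>1 / e\<close>, uniformly in
      \<open>x \<ge> 0\<close>.\<close>
    have bound: "norm (- of_real x * exp (- w * of_real x) :: complex) \<le> 1 / e"
      if "0 \<le> x" "w \<in> S" for w x
    proof -
      have "e * x \<le> exp (e * x)" using exp_ge_add_one_self[of "e * x"] by linarith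
      also have "\<dots> \<le> exp (Re w * x)" using that by (auto simp: S_def intro!: mult_right_mono)
      finally have "e * x * exp (- (Re w * x)) \<le> 1" by (simp add: exp_minus field_simps)
      then show ?thesis using that e by (simp add: norm_mult field_simps)
    qed
    have "((\<lambda>w. (?L w - ?L z) / (w - z)) \<longlongrightarrow>
        expectation (\<lambda>\<omega>. - of_real (X \<omega>) * exp (- z * of_real (X \<omega>)))) (at z within S)"
      unfolding tendsto_at_iff_sequentially comp_def
    proof (intro allI impI)
      fix w :: "nat \<Rightarrow> complex"
      assume w: "\<forall>i. w i \<in> S - {z}" and lim: "w \<longlonglongrightarrow> z"
      have w_at: "filterlim w (at z) sequentially"
        using w lim by (simp add: filterlim_at)
      let ?q = "\<lambda>i \<omega>. (exp (- w i * of_real (X \<omega>)) - exp (- z * of_real (X \<omega>))) / (w i - z)"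
      have wS: "w i \<in> S" and wz: "w i \<noteq> z" for i using w by auto
      have Rew: "0 < Re (w i)" for i using wS[of i] e unfolding S_def mem_Collect_eq by linarith
      have eq: "(?L (w i) - ?L z) / (w i - z) = expectation (?q i)" for i
        using int[OF Rew[of i]] int[OF z] by simp
      have "(\<lambda>i. expectation (?q i)) \<longlonglongrightarrow>
          expectation (\<lambda>\<omega>. - of_real (X \<omega>) * exp (- z * of_real (X \<omega>)))"
      proof (rule integral_dominated_convergence[where w = "\<lambda>_. 1 / e"])
        show "AE \<omega> in M. (\<lambda>i. ?q i \<omega>) \<longlonglongrightarrow> - of_real (X \<omega>) * exp (- z * of_real (X \<omega>))"
        proof (intro AE_I2)
          fix \<omega>
          show "(\<lambda>i. ?q i \<omega>) \<longlonglongrightarrow> - of_real (X \<omega>) * exp (- z * of_real (X \<omega>))"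
            using deriv[of "X \<omega>" z UNIV] unfolding has_field_derivative_iff
            by (rule filterlim_compose[OF _ w_at])
        qed
        show "AE \<omega> in M. norm (?q i \<omega>) \<le> 1 / e" for i
        proof (intro AE_I2)
          fix \<omega> assume "\<omega> \<in> space M"
          have "norm (exp (- w i * of_real (X \<omega>)) - exp (- z * of_real (X \<omega>))) \<le> 1 / e * norm (w i - z)"
            by (rule field_differentiable_bound[OF cS deriv bound[OF Xn[OF \<open>\<omega> \<in> space M\<close>]] wS zS])
          then show "norm (?q i \<omega>) \<le> 1 / e"
            using wz[of i] by (simp add: norm_divide divide_le_eq)
        qed
      qed auto
      then show "(\<lambda>i. (?L (w i) - ?L z) / (w i - z)) \<longlonglongrightarrow>
          expectation (\<lambda>\<omega>. - of_real (X \<omega>) * exp (- z * of_real (X \<omega>)))"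
        by (simp only: eq)
    qed
    then show ?thesis
      by (simp only: has_field_derivative_iff at_within_open[OF zS oS])
  qed
  then show ?thesis
    by (auto simp only: holomorphic_on_open[OF open_halfspace_Re_gt] mem_Collect_eq)
qed

text \<open>On the principal branch \<open>- \<i> * w\<close> has modulus
  \<open>\<bar>w\<bar>\<close> and argument \<open>- sgn w * pi / 2\<close>. This sign is the source
  of the skewness term of the stable law.\<close>

lemma minus_ii_mult_powr:
  assumes "w \<noteq> 0"
  shows "(- (\<i> * complex_of_real w)) powr complex_of_real a =
    complex_of_real (\<bar>w\<bar> powr a) * (cos (pi * a / 2) - \<i> * complex_of_real (sgn w) * sin (pi * a / 2))"
proof -
  have Ln: "Ln (- (\<i> * complex_of_real w)) = of_real (ln \<bar>w\<bar>) + \<i> * of_real (- (pi / 2 * sgn w))"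
  proof (cases "0 < w")
    case True
    have "Ln (of_real w * (- \<i>)) = ln w + Ln (- \<i>)"
      using Ln_times_of_real[OF True, of "- \<i>"] True by (simp add: Ln_of_real)
    then show ?thesis using True by (simp add: mult.commute)
  next
    case False
    then have w: "w < 0" using assms by simp
    have "Ln (of_real (- w) * \<i>) = ln (- w) + Ln \<i>"
      using Ln_times_of_real[of "- w" \<i>] w by (simp add: Ln_of_real del: of_real_minus)
    then show ?thesis using w by (simp add: mult.commute)
  qed
  have "of_real a * Ln (- (\<i> * complex_of_real w)) =
      of_real (a * ln \<bar>w\<bar>) + \<i> * of_real (- (pi * a / 2 * sgn w))"
    unfolding Ln by (simp add: right_diff_distrib mult_ac)
  then have "(- (\<i> * complex_of_real w)) powr complex_of_real a =
      exp (of_real (a * ln \<bar>w\<bar>) + \<i> * of_real (- (pi * a / 2 * sgn w)))"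
    using assms by (simp only: powr_def) simp
  also have "\<dots> = of_real (exp (a * ln \<bar>w\<bar>)) * exp (\<i> * of_real (- (pi * a / 2 * sgn w)))"
    by (simp only: exp_add exp_of_real)
  also have "exp (a * ln \<bar>w\<bar>) = \<bar>w\<bar> powr a"
    using assms by (simp add: powr_def)
  also have "exp (\<i> * of_real (- (pi * a / 2 * sgn w))) =
      cos (pi * a / 2) - \<i> * complex_of_real (sgn w) * sin (pi * a / 2)"
    unfolding exp_Euler cos_of_real sin_of_real
    using assms by (cases "0 < w") (simp_all add: sgn_if)
  finally show ?thesis .
qed

text \<open>The characteristic function at \<open>w\<close> is the Laplace transform at the boundary
  point \<open>- \<i> * w\<close>. The formula known on the positive reals spreads to the open
  half-plane by the identity theorem and then to the boundary by continuity;
  \<open>w \<noteq> 0\<close> keeps the limit point off the branch cut.\<close>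

lemma (in prob_space) char_of_Laplace_transform_powr:
  assumes X[measurable]: "X \<in> borel_measurable M" and Xn: "\<And>\<omega>. \<omega> \<in> space M \<Longrightarrow> 0 \<le> X \<omega>"
    and L: "\<And>s. 0 < s \<Longrightarrow> expectation (\<lambda>\<omega>. exp (- s * X \<omega>)) = exp (- (c * s powr a))"
    and w: "w \<noteq> 0"
  shows "char (distr M borel X) w = exp (- of_real c * (- (\<i> * complex_of_real w)) powr of_real a)"
proof -
  let ?L = "\<lambda>z. expectation (\<lambda>\<omega>. exp (- z * complex_of_real (X \<omega>)))"
  let ?G = "\<lambda>z. exp (- of_real c * z powr complex_of_real a)"
  have eq: "?L z = ?G z" if "0 < Re z" for z
  proof -
    let ?S = "{z. 0 < Re z}" and ?U = "complex_of_real ` {0<..}"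
    have "?L z - ?G z = 0"
    \<comment> \<open>The positive reals accumulate at 1, an interior point of the half-plane, so a
      holomorphic difference vanishing on them is zero.\<close>
    proof (rule analytic_continuation[where S = ?S and U = ?U and \<xi> = 1 and f = "\<lambda>z. ?L z - ?G z"])
      have "?G holomorphic_on ?S"
        by (intro holomorphic_intros) (auto simp: complex_nonpos_Reals_iff)
      then show "(\<lambda>z. ?L z - ?G z) holomorphic_on ?S"
        by (intro holomorphic_on_diff holomorphic_Laplace_transform[OF X Xn])
      show "open ?S" by (rule open_halfspace_Re_gt)
      show "connected ?S" by (intro convex_connected convex_halfspace_Re_gt)
      show "?U \<subseteq> ?S" "1 \<in> ?S" by auto
      show "1 islimpt ?U"
        unfolding islimpt_approachable
      proof (intro allI impI)
        fix e :: real assume "0 < e"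
        then show "\<exists>x'\<in>?U. x' \<noteq> 1 \<and> dist x' 1 < e"
          by (intro bexI[OF _ imageI[of "1 + e / 2"]]) (auto simp: dist_norm simp del: of_real_divide)
      qed
      show "?L z - ?G z = 0" if "z \<in> ?U" for z
      proof -
        from that obtain s where s: "0 < s" "z = of_real s" by auto
        have "?L z = of_real (expectation (\<lambda>\<omega>. exp (- s * X \<omega>)))"
          by (simp add: s exp_of_real flip: of_real_mult of_real_minus)
        also have "\<dots> = ?G z"
          using s L[OF s(1)] by (simp add: powr_of_real flip: exp_of_real)
        finally show ?thesis by simp
      qed
    qed (use that in simp)
    then show ?thesis by simp
  qed
  \<comment> \<open>The boundary point is approached horizontally from inside the half-plane, where
    the integrands are bounded by 1.\<close>
  let ?z = "\<lambda>n. complex_of_real (inverse (real (Suc n))) - \<i> * of_real w"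
  have z: "?z \<longlonglongrightarrow> 0 - \<i> * of_real w"
    by (intro tendsto_diff tendsto_const)
      (use tendsto_of_real[OF LIMSEQ_inverse_real_of_nat, where 'a = complex] in \<open>simp only: of_real_0\<close>)
  have "(\<lambda>n. ?L (?z n)) \<longlonglongrightarrow> expectation (\<lambda>\<omega>. exp (- (0 - \<i> * of_real w) * complex_of_real (X \<omega>)))"
  proof (rule integral_dominated_convergence[where w = "\<lambda>_. 1"])
    show "AE \<omega> in M. norm (exp (- ?z n * of_real (X \<omega>))) \<le> 1" for n
      using Xn by (intro AE_I2) auto
    show "AE \<omega> in M. (\<lambda>n. exp (- ?z n * of_real (X \<omega>))) \<longlonglongrightarrow> exp (- (0 - \<i> * of_real w) * of_real (X \<omega>))"
      by (intro AE_I2 tendsto_intros z)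
  qed auto
  moreover have "(\<lambda>n. ?G (?z n)) \<longlonglongrightarrow> ?G (0 - \<i> * of_real w)"
  proof (intro tendsto_exp tendsto_mult tendsto_const tendsto_powr_complex z)
    show "0 - \<i> * complex_of_real w \<notin> \<real>\<^sub>\<le>\<^sub>0" using w by (simp add: complex_nonpos_Reals_iff)
  qed
  moreover have "?L (?z n) = ?G (?z n)" for n
    by (rule eq) simp
  ultimately have "expectation (\<lambda>\<omega>. exp (- (0 - \<i> * of_real w) * complex_of_real (X \<omega>))) = ?G (0 - \<i> * of_real w)"
    by (simp only: LIMSEQ_unique)
  then show ?thesis
    by (simp add: char_def integral_distr mult.assoc)
qed

text \<open>Factoring the cosine out of
  \<open>cos (pi * a / 2) - \<i> * sgn w * sin (pi * a / 2)\<close> produces the tangent with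
  skewness 1 and moves the cosine into the dispersion. It is positive because
  \<open>0 < a < 1\<close>. The point \<open>w = 0\<close> is separate, as the power formula
  excludes it.\<close>

lemma (in prob_space) is_stable_of_Laplace_transform:
  assumes X[measurable]: "X \<in> borel_measurable M" and Xn: "\<And>\<omega>. \<omega> \<in> space M \<Longrightarrow> 0 \<le> X \<omega>"
    and L: "\<And>s. 0 < s \<Longrightarrow> expectation (\<lambda>\<omega>. exp (- s * X \<omega>)) = exp (- (c * s powr a))"
    and a: "0 < a" "a < 1" and c: "0 \<le> c"
  shows "is_stable a 1 (c * cos (pi * a / 2)) (distr M borel X)"
proof -
  have "pi * a / 2 < pi / 2" using a by simp
  then have cos: "0 < cos (pi * a / 2)"
    using a by (intro cos_gt_zero) auto
  have "char (distr M borel X) w = exp (- complex_of_real (c * cos (pi * a / 2) * \<bar>w\<bar> powr a)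
      * (1 - \<i> * complex_of_real (1 * sgn w * tan (pi * a / 2))))" for w
  proof (cases "w = 0")
    case True
    then show ?thesis
      using real_distribution.char_zero[OF real_distribution_distr[OF X]] by simp
  next
    case False
    define C S where "C = complex_of_real (cos (pi * a / 2))" and "S = complex_of_real (sin (pi * a / 2))"
    have "C \<noteq> 0" using cos by (simp add: C_def)
    then have "- of_real c * (of_real (\<bar>w\<bar> powr a) * (C - \<i> * of_real (sgn w) * S)) =
        - (of_real c * C * of_real (\<bar>w\<bar> powr a)) * (1 - \<i> * (of_real (sgn w) * (S / C)))"
      by (simp add: field_simps)
    then have "- of_real c * (of_real (\<bar>w\<bar> powr a) * (C - \<i> * of_real (sgn w) * S)) =
        - (of_real c * C * of_real (\<bar>w\<bar> powr a)) * (1 - \<i> * (of_real (sgn w) * (S / C)))"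
      by (simp add: field_simps)
    then have "exp (- of_real c * (of_real (\<bar>w\<bar> powr a) * (C - \<i> * of_real (sgn w) * S))) =
        exp (- (of_real c * C * of_real (\<bar>w\<bar> powr a)) * (1 - \<i> * (of_real (sgn w) * (S / C))))"
      by (rule arg_cong)
    moreover have "char (distr M borel X) w = exp (- of_real c * (- (\<i> * complex_of_real w)) powr of_real a)"
      by (rule char_of_Laplace_transform_powr[OF X Xn L False])
    ultimately show ?thesis
      by (simp only: minus_ii_mult_powr[OF False] tan_def C_def S_def of_real_mult of_real_divide mult_1)
  qed
  then show ?thesis
    unfolding is_stable_def using a c cos by (auto intro!: real_distribution_distr)
qed

section \<open>Absence of atoms\<close>

text \<open>
  Averaging \<open>exp (\<i> n (y - x) t)\<close> over a standard normal \<open>t\<close> and over \<open>y\<close> distributed as \<open>M\<close> gives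
  the mean of \<open>exp (- (n (y - x))\<^sup>2 / 2)\<close>, which tends to \<open>prob {x}\<close>; in the other order of
  integration it is a normal mean of values of \<open>char M\<close> at \<open>n t\<close>, which tends to \<open>0\<close>.
\<close>
lemma (in real_distribution) no_atom_of_char_tendsto_0:
  assumes "(char M \<longlongrightarrow> 0) at_infinity"
  shows "prob {x} = 0"
proof -
  let ?N = std_normal_distribution
  interpret N: real_distribution ?N by (rule real_dist_normal_dist)
  interpret P: pair_prob_space ?N M ..
  define I where "I n = (CLINT y|M. CLINT t|?N. iexp ((real n * (y - x)) * t))" for n
  have I1: "I n = (CLINT y|M. complex_of_real (exp (- ((real n * (y - x))\<^sup>2) / 2)))" for n
    unfolding I_def char_def[symmetric] char_std_normal_distribution ..
  have "I \<longlonglongrightarrow> (CLINT y|M. complex_of_real (indicator {x} y))"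
    unfolding I1
  proof (rule integral_dominated_convergence[where w = "\<lambda>_. 1"])
    show "AE y in M. (\<lambda>n. complex_of_real (exp (- ((real n * (y - x))\<^sup>2) / 2))) \<longlonglongrightarrow> of_real (indicator {x} y)"
    proof (intro AE_I2 tendsto_of_real)
      fix y
      show "(\<lambda>n. exp (- ((real n * (y - x))\<^sup>2) / 2)) \<longlonglongrightarrow> indicator {x} y"
      proof (cases "y = x")
        case False
        then have "0 < (y - x)\<^sup>2" by simp
        then have "(\<lambda>n. exp (- ((real n)\<^sup>2 * (y - x)\<^sup>2) / 2)) \<longlonglongrightarrow> 0"
          by real_asymp
        then show ?thesis using False by (simp only: power_mult_distrib) simp
      qed simp
    qed
  qed auto
  then have lim1: "I \<longlonglongrightarrow> complex_of_real (prob {x})"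
    by simp
  have I2: "I n = (CLINT t|?N. iexp (- (t * real n * x)) * char M (t * real n))" for n
  proof -
    have "I n = (CLINT t|?N. CLINT y|M. iexp ((real n * (y - x)) * t))"
      unfolding I_def
      by (intro P.Fubini_integral P.integrable_const_bound[where B = 1]) auto
    also have "\<dots> = (CLINT t|?N. CLINT y|M. iexp (- (t * real n * x)) * iexp (t * real n * y))"
      unfolding exp_add[symmetric] by (simp add: right_diff_distrib mult_ac)
    finally show ?thesis by (simp add: char_def)
  qed
  have "I \<longlonglongrightarrow> (CLINT t|?N. 0)"
    unfolding I2
  proof (rule integral_dominated_convergence[where w = "\<lambda>_. 1"])
    show "AE t in ?N. norm (iexp (- (t * real n * x)) * char M (t * real n)) \<le> 1" for n
      by (intro AE_I2) (simp add: norm_mult cmod_char_le_1)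
    \<comment> \<open>At \<open>t = 0\<close> the argument \<open>t * real n\<close> stays at 0,
      where the characteristic function is 1; this null set is removed before taking the
      limit.\<close>
    have "AE t in ?N. t \<noteq> 0"
      using AE_lborel_singleton[of "0::real"] by (subst AE_density) auto
    then show "AE t in ?N. (\<lambda>n. iexp (- (t * real n * x)) * char M (t * real n)) \<longlonglongrightarrow> 0"
    proof eventually_elim
      case (elim t)
      have "filterlim (\<lambda>n. t * real n) at_infinity sequentially"
        using elim by (intro tendsto_mult_filterlim_at_infinity[OF tendsto_const] filterlim_real_sequentially
            filterlim_at_top_imp_at_infinity) auto
      then have "(\<lambda>n. norm (char M (t * real n))) \<longlonglongrightarrow> 0"
        using assms by (intro tendsto_norm_zero filterlim_compose[OF assms])
      then show ?case
        by (subst tendsto_norm_zero_iff[symmetric]) (simp add: norm_mult)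
    qed
  qed (auto simp: real_distribution.char_measurable[OF real_distribution_axioms])
  then have "I \<longlonglongrightarrow> 0" by simp
  from LIMSEQ_unique[OF lim1 this] show ?thesis by simp
qed

text \<open>The skewness only affects the phase, so the modulus of the characteristic function is
  \<open>exp (- \<gamma> * \<bar>w\<bar> powr \<alpha>)\<close>, which tends to 0 when
  \<open>\<gamma> > 0\<close>.\<close>

lemma is_stable_no_atom:
  assumes s: "is_stable \<alpha> \<beta> \<gamma> \<mu>" and \<gamma>: "0 < \<gamma>"
  shows "measure \<mu> {x} = 0"
proof -
  interpret real_distribution \<mu> using s by (simp add: is_stable_def)
  have a: "0 < \<alpha>" using s by (simp add: is_stable_def)
  have n: "norm (char \<mu> w) = exp (- (\<gamma> * norm w powr \<alpha>))" for w
    using s by (simp add: is_stable_def)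
  have "filterlim (\<lambda>x. - (\<gamma> * x powr \<alpha>)) at_bot at_top"
    using a \<gamma> by real_asymp
  then have "((\<lambda>x. exp (- (\<gamma> * x powr \<alpha>))) \<longlongrightarrow> 0) at_top"
    by (rule filterlim_compose[OF exp_at_bot])
  then have "((\<lambda>w::real. exp (- (\<gamma> * norm w powr \<alpha>))) \<longlongrightarrow> 0) at_infinity"
    by (rule filterlim_compose) (rule filterlim_norm_at_top)
  then have "(char \<mu> \<longlongrightarrow> 0) at_infinity"
    by (subst tendsto_norm_zero_iff[symmetric]) (simp add: n)
  then show ?thesis by (rule no_atom_of_char_tendsto_0)
qed

section \<open>Ordered distances and the path-loss integral\<close>

text \<open>The infimum is attained: by local finiteness some thin shell just outside the closed
  ball of radius \<open>r\<close> contains no points, so the count is right-continuous in the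
  radius. The assumption \<open>ne\<close> keeps the set under the infimum nonempty.\<close>

lemma ordered_dist_le_iff:
  assumes lf: "\<And>B. bounded B \<Longrightarrow> finite (S \<inter> B)"
    and ne: "\<exists>r. i < card (S \<inter> cball 0 r)"
  shows "ordered_dist S i \<le> r \<longleftrightarrow> i < card (S \<inter> cball 0 r)"
proof -
  let ?A = "{r. 0 \<le> r \<and> i < card (S \<inter> cball 0 r)}"
  have nonneg: "0 \<le> r" if "i < card (S \<inter> cball 0 r)" for r
    using that by (cases "0 \<le> r") auto
  have bdd: "bdd_below ?A" by (intro bdd_belowI[of _ 0]) auto
  show ?thesis
  proof
    assume "i < card (S \<inter> cball 0 r)"
    then show "ordered_dist S i \<le> r"
      unfolding ordered_dist_def using nonneg by (intro cInf_lower bdd) auto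
  next
    assume le: "ordered_dist S i \<le> r"
    let ?T = "S \<inter> cball 0 (r + 1) - cball 0 r"
    \<comment> \<open>The smallest norm of a point in the shell between \<open>r\<close> and
      \<open>r + 1\<close>, or \<open>r + 1\<close> if there is none. Every radius below
      \<open>m\<close> captures no point outside \<open>cball 0 r\<close>.\<close>
    define m where "m = Min (insert (r + 1) (norm ` ?T))"
    have finT: "finite ?T" using lf[OF bounded_cball] by auto
    then have "r < m" unfolding m_def by (subst Min_gr_iff) auto
    moreover have "?A \<noteq> {}" using ne nonneg by auto
    ultimately obtain q where q: "q \<in> ?A" "q < m"
      using cInf_lessD[of ?A m] le unfolding ordered_dist_def by auto
    have "S \<inter> cball 0 q \<subseteq> S \<inter> cball 0 r"
    proof (intro subsetI, rule ccontr)
      fix x assume x: "x \<in> S \<inter> cball 0 q" "x \<notin> S \<inter> cball 0 r"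
      have "m \<le> r + 1" unfolding m_def using finT by (intro Min_le) auto
      then have "x \<in> ?T" using x q by auto
      then have "m \<le> norm x" unfolding m_def using finT by (intro Min_le) auto
      then show False using x q by auto
    qed
    then have "card (S \<inter> cball 0 q) \<le> card (S \<inter> cball 0 r)"
      by (intro card_mono lf bounded_cball)
    then show "i < card (S \<inter> cball 0 r)" using q by auto
  qed
qed

lemma infinite_imp_less_card_cball:
  fixes S :: "'a::real_normed_vector set"
  assumes lf: "\<And>B. bounded B \<Longrightarrow> finite (S \<inter> B)" and inf: "infinite S"
  shows "\<exists>r. i < card (S \<inter> cball 0 r)"
proof -
  obtain T where T: "T \<subseteq> S" "finite T" "card T = Suc i"
    using infinite_arbitrarily_large[OF inf] by blast
  obtain r where r: "T \<subseteq> cball 0 r"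
    using finite_imp_bounded[OF T(2)] by (auto simp: bounded_iff subset_iff)
  have "card T \<le> card (S \<inter> cball 0 r)"
    using T r by (intro card_mono lf) auto
  then show ?thesis using T by (intro exI[of _ r]) auto
qed

text \<open>
  The ordered distances and the norms of the points define the same counting measure on the line,
  because the two measures agree on every half-line \<open>{..r}\<close>.
\<close>
lemma nn_integral_ordered_dist:
  fixes f :: "real \<Rightarrow> ennreal"
  assumes lf: "\<And>B. bounded B \<Longrightarrow> finite (S \<inter> B)" and inf: "infinite S"
    and f: "f \<in> borel_measurable borel"
  shows "(\<Sum>i. f (ordered_dist S i)) = (\<integral>\<^sup>+x. f (norm x) \<partial>count_space S)"
proof -
  let ?\<mu> = "distr (count_space UNIV) borel (ordered_dist S)"
  let ?\<nu> = "distr (count_space S) borel norm"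
  have le: "ordered_dist S i \<le> r \<longleftrightarrow> i < card (S \<inter> cball 0 r)" for i r
    by (rule ordered_dist_le_iff[OF lf infinite_imp_less_card_cball[OF lf inf]])
  have m: "emeasure ?\<mu> {..r} = of_nat (card (S \<inter> cball 0 r))" for r
  proof -
    have "ordered_dist S -` {..r} = {..<card (S \<inter> cball 0 r)}" using le by auto
    then show ?thesis by (subst emeasure_distr) auto
  qed
  have n: "emeasure ?\<nu> {..r} = of_nat (card (S \<inter> cball 0 r))" for r
  proof -
    have "norm -` {..r} \<inter> S = S \<inter> cball 0 r" by auto
    then show ?thesis using lf[of "cball 0 r"] by (subst emeasure_distr) auto
  qed
  have "?\<mu> = ?\<nu>"
  proof (rule measure_eqI_generator_eq[where E = "range atMost" and \<Omega> = UNIV and A = "\<lambda>n::nat. {..real n}"])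
    show "Int_stable (range (atMost :: real \<Rightarrow> _))"
      by (auto simp: Int_stable_def)
    show "sets ?\<mu> = sigma_sets UNIV (range atMost)" "sets ?\<nu> = sigma_sets UNIV (range atMost)"
      by (simp_all add: borel_eq_atMost)
    show "(\<Union>n. {..real n}) = UNIV"
      using real_arch_simple by auto
  qed (auto simp: m n)
  then have "(\<integral>\<^sup>+r. f r \<partial>?\<mu>) = (\<integral>\<^sup>+r. f r \<partial>?\<nu>)" by simp
  then show ?thesis
    using f by (simp add: nn_integral_distr nn_integral_count_space_nat)
qed

text \<open>Measurability is needed at every outcome, including those with at most \<open>i\<close>
  points, where the distance takes the fixed value \<open>Inf {}\<close>. Testing integer radii
  separates the two cases by countably many count events.\<close>

lemma (in homogeneous_poisson_process) measurable_ordered_dist: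
  "(\<lambda>\<omega>. ordered_dist (Eve \<omega>) i) \<in> borel_measurable M"
proof -
  let ?N = "\<lambda>r \<omega>. card (Eve \<omega> \<inter> cball 0 r)"
  have N: "?N r \<in> measurable M (count_space UNIV)" for r
    by (intro count_measurable) auto
  have mono: "?N r \<omega> \<le> ?N q \<omega>" if "r \<le> q" "\<omega> \<in> space M" for r q \<omega>
    using that by (intro card_mono locally_finite) auto
  have "(ordered_dist (Eve \<omega>) i \<le> r) \<longleftrightarrow>
      (if \<exists>n. i < ?N (real n) \<omega> then i < ?N r \<omega> else Inf {} \<le> r)" if w: "\<omega> \<in> space M" for r \<omega>
  proof (cases "\<exists>n. i < ?N (real n) \<omega>")
    case True
    then show ?thesis
      using ordered_dist_le_iff[OF locally_finite[OF w]] by auto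
  next
    case False
    have "\<not> i < ?N q \<omega>" for q
    proof -
      obtain n where "q \<le> real n" using real_arch_simple by blast
      then show ?thesis using mono[OF _ w] False by (meson less_le_trans)
    qed
    then show ?thesis using False by (simp add: ordered_dist_def)
  qed
  note eq = this
  have "{\<omega> \<in> space M. ordered_dist (Eve \<omega>) i \<le> r} =
      {\<omega> \<in> space M. if \<exists>n. i < ?N (real n) \<omega> then i < ?N r \<omega> else Inf {} \<le> r}" for r
    by (intro Collect_cong conj_cong refl eq)
  moreover have meas: "{\<omega> \<in> space M. if \<exists>n. i < ?N (real n) \<omega> then i < ?N r \<omega> else Inf {} \<le> r} \<in> sets M" for r
  proof -
    have P[measurable]: "Measurable.pred M (\<lambda>\<omega>. i < ?N q \<omega>)" for q
      using N[of q] by measurable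
    show ?thesis
      unfolding if_bool_eq_disj by (intro sets.sets_Collect P[unfolded pred_def])
  qed
  ultimately have "{\<omega> \<in> space M. ordered_dist (Eve \<omega>) i \<le> r} \<in> sets M" for r
    by (simp only:)
  then show ?thesis
    by (rule borel_measurableI_le)
qed

section \<open>The path gain as a function on the plane\<close>

lemma borel_measurable_path_gain [measurable]: "path_gain b \<in> borel_measurable borel"
  unfolding path_gain_def[abs_def] by measurable

lemma path_gain_nonneg [simp]: "0 \<le> path_gain b r"
  by (simp add: path_gain_def)

text \<open>The superlevel set is a disc of radius \<open>(s / t) powr (1 / (2 * b))\<close> without
  its centre: division by zero makes \<open>path_gain b 0\<close> equal to 0, below the threshold. A
  single point does not change the area.\<close>

lemma emeasure_path_gain_ge:
  assumes b: "0 < b" and st: "0 < s" "0 < t"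
  shows "emeasure lborel {x :: real ^ 2. t \<le> s * path_gain b (norm x)} =
    ennreal (pi * s powr (1 / b) * t powr (- (1 / b)))"
proof -
  define \<rho> where "\<rho> = (s / t) powr (1 / (2 * b))"
  have \<rho>: "0 < \<rho>" using st by (simp add: \<rho>_def)
  have "t \<le> s * path_gain b (norm x) \<longleftrightarrow> x \<noteq> 0 \<and> norm x \<le> \<rho>" for x :: "real ^ 2"
  proof (cases "x = 0")
    case False
    then have "t \<le> s * path_gain b (norm x) \<longleftrightarrow> norm x powr (2 * b) \<le> s / t"
      using st by (simp add: path_gain_def field_simps)
    also have "s / t = \<rho> powr (2 * b)"
      using b st by (simp add: \<rho>_def powr_powr)
    also have "norm x powr (2 * b) \<le> \<rho> powr (2 * b) \<longleftrightarrow> norm x \<le> \<rho>"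
    proof
      assume "norm x \<le> \<rho>"
      then show "norm x powr (2 * b) \<le> \<rho> powr (2 * b)" using b by (intro powr_mono2) auto
    next
      assume le: "norm x powr (2 * b) \<le> \<rho> powr (2 * b)"
      show "norm x \<le> \<rho>"
      proof (rule ccontr)
        assume "\<not> norm x \<le> \<rho>"
        then have "\<rho> powr (2 * b) < norm x powr (2 * b)" using b \<rho> by (intro powr_less_mono2) auto
        then show False using le by simp
      qed
    qed
    finally show ?thesis using False by simp
  qed (use st in \<open>simp add: path_gain_def\<close>)
  then have "{x :: real ^ 2. t \<le> s * path_gain b (norm x)} = cball 0 \<rho> - {0}"
    by (simp only: set_eq_iff mem_Collect_eq) (simp add: conj_commute)
  also have "emeasure lborel (cball 0 \<rho> - {0 :: real ^ 2}) = emeasure lborel (cball 0 \<rho> :: (real ^ 2) set)"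
    by (intro emeasure_Diff_null_set) auto
  also have "\<dots> = ennreal (pi * \<rho>\<^sup>2)"
    using \<rho> by (simp add: emeasure_cball unit_ball_vol_2)
  also have "\<rho>\<^sup>2 = \<rho> powr 2"
    using \<rho> by (simp only: powr_numeral)
  also have "\<rho> powr 2 = s powr (1 / b) * t powr (- (1 / b))"
  proof -
    have "\<rho> powr 2 = (s / t) powr (1 / b)" by (simp add: \<rho>_def powr_powr)
    also have "\<dots> = s powr (1 / b) / t powr (1 / b)" using st by (simp add: powr_divide)
    finally show ?thesis by (simp only: powr_minus divide_inverse)
  qed
  finally show ?thesis by (simp only: mult.assoc)
qed

text \<open>Layer cake: \<open>1 - exp (- y)\<close> is the integral of \<open>exp (- t)\<close> over \<open>0 \<le> t \<le> y\<close>.\<close>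
lemma nn_integral_one_minus_exp_path_gain:
  assumes b: "1 < b" and s: "0 < s"
  shows "(\<integral>\<^sup>+x. ennreal (1 - exp (- (s * path_gain b (norm (x :: real ^ 2))))) \<partial>lborel) =
    ennreal (pi * Gamma (1 - 1 / b) * s powr (1 / b))"
proof -
  let ?y = "\<lambda>x :: real ^ 2. s * path_gain b (norm x)"
  let ?g = "\<lambda>x t. if 0 < t \<and> t \<le> ?y x then ennreal (exp (- t)) else 0"
  have "ennreal (1 - exp (- ?y x)) = (\<integral>\<^sup>+t. ?g x t \<partial>lborel)" for x
  proof -
    have "(\<integral>\<^sup>+t. ennreal (exp (- t)) * indicator {0..?y x} t \<partial>lborel) = ennreal (- exp (- ?y x) - (- exp (- 0)))"
      using s by (intro nn_integral_FTC_Icc) (auto intro!: derivative_eq_intros)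
    moreover have "(\<integral>\<^sup>+t. ennreal (exp (- t)) * indicator {0..?y x} t \<partial>lborel) = (\<integral>\<^sup>+t. ?g x t \<partial>lborel)"
      using AE_lborel_singleton[of "0 :: real"]
      by (intro nn_integral_cong_AE) (auto simp: indicator_def elim!: eventually_mono)
    ultimately show ?thesis by simp
  qed
  then have "(\<integral>\<^sup>+x. ennreal (1 - exp (- ?y x)) \<partial>lborel) = (\<integral>\<^sup>+x. \<integral>\<^sup>+t. ?g x t \<partial>lborel \<partial>lborel)"
    by simp
  also have "\<dots> = (\<integral>\<^sup>+t. \<integral>\<^sup>+x. ?g x t \<partial>lborel \<partial>lborel)"
    by (rule lborel_pair.Fubini'[symmetric]) measurable
  \<comment> \<open>For \<open>t > 0\<close> the inner integral is \<open>exp (- t)\<close> times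
    the area of a disc. The exponent \<open>- (1 / b)\<close> is written as
    \<open>1 - 1 / b - 1\<close> to match the Gamma integral at \<open>1 - 1 / b\<close>, which is
    positive since \<open>b > 1\<close>.\<close>
  also have "\<dots> = (\<integral>\<^sup>+t. ennreal (pi * s powr (1 / b)) *
      ennreal (indicator {0..} t * t powr (1 - 1 / b - 1) / exp t) \<partial>lborel)"
  proof (intro nn_integral_cong_AE)
    show "AE t in lborel. (\<integral>\<^sup>+x. ?g x t \<partial>lborel) = ennreal (pi * s powr (1 / b)) *
      ennreal (indicator {0..} t * t powr (1 - 1 / b - 1) / exp t)"
      using AE_lborel_singleton[of "0 :: real"]
    proof eventually_elim
      case (elim t)
      show ?case
      proof (cases "0 < t")
        case True
        have "(\<integral>\<^sup>+x. ?g x t \<partial>lborel) =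
            (\<integral>\<^sup>+x. ennreal (exp (- t)) * indicator {x. t \<le> ?y x} x \<partial>lborel)"
          using True by (intro nn_integral_cong) (auto simp: indicator_def)
        also have "\<dots> = ennreal (exp (- t)) * ennreal (pi * s powr (1 / b) * t powr (- (1 / b)))"
          using b s True by (subst nn_integral_cmult_indicator) (auto simp: emeasure_path_gain_ge)
        finally show ?thesis
          using True by (simp add: exp_minus field_simps flip: ennreal_mult')
      qed (use elim in auto)
    qed
  qed
  also have "\<dots> = ennreal (pi * s powr (1 / b)) *
      (\<integral>\<^sup>+t. ennreal (indicator {0..} t * t powr (1 - 1 / b - 1) / exp t) \<partial>lborel)"
    by (intro nn_integral_cmult) measurable
  also have "\<dots> = ennreal (pi * s powr (1 / b)) * ennreal (Gamma (1 - 1 / b))"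
    using b by (subst Gamma_conv_nn_integral_real) auto
  also have "\<dots> = ennreal (pi * s powr (1 / b) * Gamma (1 - 1 / b))"
    by (rule ennreal_mult'[symmetric]) simp
  also have "pi * s powr (1 / b) * Gamma (1 - 1 / b) = pi * Gamma (1 - 1 / b) * s powr (1 / b)"
    by simp
  finally show ?thesis .
qed

section \<open>The aggregate path gain of the eavesdroppers\<close>

context homogeneous_poisson_process
begin

text \<open>The Laplace functional at the constant 1 concerns the total number of points. The plane
  has infinite area, so the expectation of the nonnegative \<open>nexp\<close> is 0, which forces an
  infinite count almost surely.\<close>

lemma AE_infinite:
  assumes lam: "0 < lam"
  shows "AE \<omega> in M. infinite (Eve \<omega>)"
proof -
  let ?Z = "\<lambda>\<omega>. \<integral>\<^sup>+x. ennreal 1 \<partial>count_space (Eve \<omega>)"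
  have m: "?Z \<in> borel_measurable M"
    using lam by (intro measurable_count_integral) auto
  have "expectation (\<lambda>\<omega>. nexp (?Z \<omega>)) =
      nexp (ennreal lam * (\<integral>\<^sup>+x. ennreal (1 - exp (- 1)) \<partial>(lborel :: (real ^ 2) measure)))"
    using lam by (intro Laplace_functional) auto
  also have "\<dots> = 0"
    using lam by (simp add: ennreal_mult_top ennreal_top_mult ennreal_mult_eq_top_iff)
  finally have "expectation (\<lambda>\<omega>. nexp (?Z \<omega>)) = 0" .
  moreover have "integrable M (\<lambda>\<omega>. nexp (?Z \<omega>))"
    by (intro integrable_const_bound[where B = 1] AE_I2 measurable_compose[OF m borel_measurable_nexp]) simp
  ultimately have "AE \<omega> in M. nexp (?Z \<omega>) = 0"
    by (subst (asm) integral_nonneg_eq_0_iff_AE) auto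
  then show ?thesis
  proof eventually_elim
    case (elim \<omega>)
    then show ?case
      using ennreal_of_nat_neq_top[of "card (Eve \<omega>)"] by (auto simp del: ennreal_1 simp: ennreal_1)
  qed
qed

text \<open>An extended value, so that the Laplace functional applies before almost sure finiteness
  is known.\<close>

definition path_loss_sum :: "real \<Rightarrow> 'w \<Rightarrow> ennreal" where
  "path_loss_sum b \<omega> = (\<integral>\<^sup>+x. ennreal (path_gain b (norm x)) \<partial>count_space (Eve \<omega>))"

lemma measurable_path_loss_sum:
  assumes "0 < lam"
  shows "path_loss_sum b \<in> borel_measurable M"
  unfolding path_loss_sum_def[abs_def] using assms by (intro measurable_count_integral) auto

lemma Laplace_path_loss_sum:
  assumes lam: "0 < lam" and b: "1 < b" and s: "0 < s"
  shows "expectation (\<lambda>\<omega>. nexp (ennreal s * path_loss_sum b \<omega>)) =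
    exp (- (pi * lam * Gamma (1 - 1 / b) * s powr (1 / b)))"
proof -
  have G: "0 < Gamma (1 - 1 / b)" using b by (intro Gamma_real_pos) auto
  have "ennreal s * path_loss_sum b \<omega> =
      (\<integral>\<^sup>+x. ennreal (s * path_gain b (norm x)) \<partial>count_space (Eve \<omega>))" for \<omega>
    using s by (simp add: path_loss_sum_def nn_integral_cmult ennreal_mult)
  then have "expectation (\<lambda>\<omega>. nexp (ennreal s * path_loss_sum b \<omega>)) =
      nexp (ennreal lam * (\<integral>\<^sup>+x. ennreal (1 - exp (- (s * path_gain b (norm (x :: real ^ 2))))) \<partial>lborel))"
    using lam s by (simp only:) (intro Laplace_functional, auto)
  also have "\<dots> = nexp (ennreal (pi * lam * Gamma (1 - 1 / b) * s powr (1 / b)))"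
    using lam by (simp add: nn_integral_one_minus_exp_path_gain[OF b s] mult_ac flip: ennreal_mult')
  also have "\<dots> = exp (- (pi * lam * Gamma (1 - 1 / b) * s powr (1 / b)))"
    using lam G by (intro nexp_ennreal) auto
  finally show ?thesis .
qed

text \<open>Since \<open>nexp\<close> vanishes at \<open>\<top>\<close> and is at most 1, the
  Laplace transform at every \<open>s > 0\<close> bounds the probability of finiteness from below.
  It tends to 1 as \<open>s\<close> decreases to 0.\<close>

lemma AE_path_loss_sum_finite:
  assumes lam: "0 < lam" and b: "1 < b"
  shows "AE \<omega> in M. path_loss_sum b \<omega> \<noteq> \<top>"
proof -
  note [measurable] = measurable_path_loss_sum[OF lam]
  let ?F = "{\<omega> \<in> space M. path_loss_sum b \<omega> \<noteq> \<top>}"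
  let ?c = "pi * lam * Gamma (1 - 1 / b)"
  have "exp (- (?c * s powr (1 / b))) \<le> prob ?F" if s: "0 < s" for s
  proof -
    have "expectation (\<lambda>\<omega>. nexp (ennreal s * path_loss_sum b \<omega>)) \<le> expectation (indicator ?F)"
    proof (intro integral_mono)
      show "integrable M (\<lambda>\<omega>. nexp (ennreal s * path_loss_sum b \<omega>))"
        by (intro integrable_const_bound[where B = 1]) auto
      show "integrable M (indicat_real ?F)"
        by (intro integrable_real_indicator) (auto simp: emeasure_eq_measure)
      show "nexp (ennreal s * path_loss_sum b \<omega>) \<le> indicator ?F \<omega>" if "\<omega> \<in> space M" for \<omega>
        using that s by (auto simp: indicator_def ennreal_mult_top)
    qed
    then show ?thesis
      by (simp add: Laplace_path_loss_sum[OF lam b s])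
  qed
  moreover have "((\<lambda>s. exp (- (?c * s powr (1 / b)))) \<longlongrightarrow> exp (- (?c * 0 powr (1 / b)))) (at_right 0)"
    using b by (intro tendsto_intros tendsto_powr') (auto simp: eventually_at_right_less[THEN eventually_mono])
  ultimately have "1 \<le> prob ?F"
    by (intro tendsto_upperbound[where F = "at_right (0 :: real)"])
      (auto intro: eventually_mono[OF eventually_at_right_less])
  then have "prob ?F = 1" by (intro antisym) auto
  then show ?thesis by (subst (asm) prob_Collect_eq_1) auto
qed

lemma Laplace_enn2real_path_loss_sum:
  assumes lam: "0 < lam" and b: "1 < b" and s: "0 < s"
  shows "expectation (\<lambda>\<omega>. exp (- s * enn2real (path_loss_sum b \<omega>))) =
    exp (- (pi * lam * Gamma (1 - 1 / b) * s powr (1 / b)))"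
proof -
  note [measurable] = measurable_path_loss_sum[OF lam]
  have "expectation (\<lambda>\<omega>. exp (- s * enn2real (path_loss_sum b \<omega>))) =
      expectation (\<lambda>\<omega>. nexp (ennreal s * path_loss_sum b \<omega>))"
  proof (intro integral_cong_AE)
    show "AE \<omega> in M. exp (- s * enn2real (path_loss_sum b \<omega>)) = nexp (ennreal s * path_loss_sum b \<omega>)"
      using AE_path_loss_sum_finite[OF lam b]
      by eventually_elim (use s in \<open>simp add: nexp_def ennreal_mult_eq_top_iff enn2real_mult\<close>)
  qed auto
  then show ?thesis by (simp add: Laplace_path_loss_sum[OF lam b s])
qed

text \<open>Links the real series in \<open>secrecy_rate\<close> to the integral over the points. An
  infinite configuration makes every ordered distance meaningful, and a finite aggregate makes the
  series summable.\<close>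

lemma AE_suminf_path_gain:
  assumes lam: "0 < lam" and b: "1 < b"
  shows "AE \<omega> in M. (\<Sum>i. path_gain b (ordered_dist (Eve \<omega>) i)) = enn2real (path_loss_sum b \<omega>)"
  using AE_infinite[OF lam] AE_path_loss_sum_finite[OF lam b] AE_space
proof eventually_elim
  case (elim \<omega>)
  let ?g = "\<lambda>i. path_gain b (ordered_dist (Eve \<omega>) i)"
  have eq: "(\<Sum>i. ennreal (?g i)) = path_loss_sum b \<omega>"
    unfolding path_loss_sum_def
    using elim by (intro nn_integral_ordered_dist locally_finite) auto
  then have "summable ?g"
    using elim by (intro summable_suminf_not_top) auto
  then have "(\<Sum>i. ennreal (?g i)) = ennreal (\<Sum>i. ?g i)"
    by (intro suminf_ennreal2) auto
  then show ?case
    using \<open>summable ?g\<close> by (simp add: eq suminf_nonneg)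
qed

text \<open>With \<open>a = 1 / b\<close>, the relation
  \<open>Gamma (2 - a) = (1 - a) * Gamma (1 - a)\<close> turns the inverse of
  \<open>stable_const a\<close> into \<open>Gamma (1 - a) * cos (pi * a / 2)\<close>. Dividing by
  \<open>k\<close> divides the Laplace coefficient by \<open>k powr a\<close>, leaving
  \<open>1 / cos (pi * a / 2)\<close>, that is, dispersion 1.\<close>

lemma is_stable_path_loss_sum:
  assumes lam: "0 < lam" and b: "1 < b"
  defines "k \<equiv> (pi * lam * inverse (stable_const (1 / b))) powr b"
  shows "is_stable (1 / b) 1 1 (distr M borel (\<lambda>\<omega>. enn2real (path_loss_sum b \<omega>) / k))"
    and "0 < k"
proof -
  note [measurable] = measurable_path_loss_sum[OF lam]
  define a where "a = 1 / b"
  have a: "0 < a" "a < 1" using b by (auto simp: a_def)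
  define G where "G = Gamma (1 - a)"
  have G: "0 < G" unfolding G_def using a by (intro Gamma_real_pos) auto
  have "pi * a / 2 < pi / 2" using a by simp
  then have cos: "0 < cos (pi * a / 2)"
    using a by (intro cos_gt_zero) auto
  have "1 - a \<notin> \<int>\<^sub>\<le>\<^sub>0"
    using nonpos_Ints_nonpos[of "1 - a"] a by auto
  then have "Gamma (2 - a) = (1 - a) * G"
    using Gamma_plus1[of "1 - a"] by (simp add: G_def)
  then have const: "inverse (stable_const a) = G * cos (pi * a / 2)"
    using a by (simp add: stable_const_def)
  have k_eq: "k = (pi * lam * (G * cos (pi * a / 2))) powr b"
    unfolding k_def using const by (simp add: a_def)
  have pos: "0 < pi * lam * (G * cos (pi * a / 2))" using lam G cos by simp
  then show k: "0 < k" using lam G cos by (simp add: k_eq)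
  have ka: "k powr a = pi * lam * (G * cos (pi * a / 2))"
    unfolding k_eq using pos b by (simp add: powr_powr a_def)
  have "is_stable a 1 (1 / cos (pi * a / 2) * cos (pi * a / 2))
      (distr M borel (\<lambda>\<omega>. enn2real (path_loss_sum b \<omega>) / k))"
  proof (rule is_stable_of_Laplace_transform)
    show "expectation (\<lambda>\<omega>. exp (- s * (enn2real (path_loss_sum b \<omega>) / k))) =
        exp (- (1 / cos (pi * a / 2) * s powr a))" if s: "0 < s" for s
    proof -
      have "pi * lam * G * (s / k) powr a = 1 / cos (pi * a / 2) * s powr a"
        using s k lam G cos by (simp add: powr_divide ka)
      then show ?thesis
        using Laplace_enn2real_path_loss_sum[OF lam b, of "s / k"] s k
        by (simp add: a_def G_def)
    qed
  qed (use a cos k in auto)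
  then show "is_stable (1 / b) 1 1 (distr M borel (\<lambda>\<omega>. enn2real (path_loss_sum b \<omega>) / k))"
    using cos by (simp add: a_def)
qed

end

section \<open>The secrecy rate\<close>

theorem theorem6p2:
  fixes M :: "'w measure" and Eve :: "'w \<Rightarrow> (real ^ 2) set"
    and lam b rl P sl2 se2 :: real
  assumes poisson: "homogeneous_poisson_process M Eve lam"
    and "lam > 0" and "b > 1" and "rl > 0"
    and "P > 0" and "sl2 > 0" and "se2 > 0"
  defines "Rs \<equiv> (\<lambda>\<omega>. secrecy_rate P sl2 se2 (path_gain b) rl (Eve \<omega>))"
  shows "Rs \<in> borel_measurable M \<and>
    (\<forall>\<rho>. cdf (distr M borel Rs) \<rho> =
      (if \<rho> < 0 then 0
       else if \<rho> < legit_capacity P sl2 b rl then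
         1 - cdf (stable_measure (1 / b) 1 1)
               (((1 + P / (rl powr (2 * b) * sl2)) * 2 powr (- \<rho>) - 1)
                / ((pi * lam * inverse (stable_const (1 / b))) powr b * (P / se2)))
       else 1))"
proof -
  interpret homogeneous_poisson_process M Eve lam by (rule poisson)
  note lam = \<open>lam > 0\<close> and b = \<open>b > 1\<close>
  note [measurable] = measurable_path_loss_sum[OF lam] measurable_ordered_dist
  define A where "A = 1 + P / (rl powr (2 * b) * sl2)"
  define k where "k = (pi * lam * inverse (stable_const (1 / b))) powr b"
  define X where "X \<omega> = enn2real (path_loss_sum b \<omega>)" for \<omega>
  let ?\<mu> = "distr M borel (\<lambda>\<omega>. X \<omega> / k)"
  have stable: "is_stable (1 / b) 1 1 ?\<mu>" and k: "0 < k"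
    unfolding X_def k_def by (rule is_stable_path_loss_sum[OF lam b])+
  have X[measurable]: "X \<in> borel_measurable M" unfolding X_def[abs_def] by measurable
  have Xn: "0 \<le> X \<omega>" for \<omega> by (simp add: X_def)
  have A: "1 < A" using assms by (simp add: A_def)
  have cap: "legit_capacity P sl2 b rl = log 2 A" by (simp add: legit_capacity_def A_def)
  \<comment> \<open>Derived from the ordered distances directly: an almost sure identity would not
    suffice, since \<open>M\<close> is not assumed complete.\<close>
  have Rs[measurable]: "Rs \<in> borel_measurable M"
    unfolding Rs_def secrecy_rate_def by measurable
  have Rs_eq: "AE \<omega> in M. Rs \<omega> = max (log 2 A - log 2 (1 + P * X \<omega> / se2)) 0"
    using AE_suminf_path_gain[OF lam b]
    by eventually_elim (simp add: Rs_def secrecy_rate_def X_def A_def path_gain_def)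
  have cdf: "cdf (distr M borel Rs) \<rho> = prob {\<omega> \<in> space M. max (log 2 A - log 2 (1 + P * X \<omega> / se2)) 0 \<le> \<rho>}" for \<rho>
  proof -
    have "cdf (distr M borel Rs) \<rho> = prob {\<omega> \<in> space M. Rs \<omega> \<le> \<rho>}"
      unfolding cdf_def by (subst measure_distr) (auto intro!: arg_cong[where f = prob])
    also have "\<dots> = prob {\<omega> \<in> space M. max (log 2 A - log 2 (1 + P * X \<omega> / se2)) 0 \<le> \<rho>}"
      by (intro finite_measure_eq_AE) (use Rs_eq in \<open>auto elim!: eventually_mono\<close>)
    finally show ?thesis .
  qed
  have arg: "1 \<le> 1 + P * X \<omega> / se2" for \<omega> using assms Xn by simp
  have "cdf (distr M borel Rs) \<rho> = (if \<rho> < 0 then 0 else if \<rho> < log 2 A then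
      1 - cdf (stable_measure (1 / b) 1 1) ((A * 2 powr (- \<rho>) - 1) / (k * (P / se2))) else 1)" for \<rho>
  proof -
    consider "\<rho> < 0" | "0 \<le> \<rho>" "\<rho> < log 2 A" | "0 \<le> \<rho>" "log 2 A \<le> \<rho>" by linarith
    then show ?thesis
    proof cases
      case 1
      then have "{\<omega> \<in> space M. max (log 2 A - log 2 (1 + P * X \<omega> / se2)) 0 \<le> \<rho>} = {}" by auto
      then show ?thesis using 1 by (simp only: cdf) simp
    next
      case 2
      let ?t = "(A * 2 powr (- \<rho>) - 1) / (k * (P / se2))"
      interpret \<mu>: real_distribution ?\<mu> by (intro real_distribution_distr) measurable
      \<comment> \<open>For \<open>\<rho> \<ge> 0\<close> the positive part has no effect on the
        event. Exponentiating to base 2 then isolates \<open>X\<close>.\<close>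
      have "max (log 2 A - log 2 (1 + P * X \<omega> / se2)) 0 \<le> \<rho> \<longleftrightarrow> ?t \<le> X \<omega> / k" for \<omega>
      proof -
        have "max (log 2 A - log 2 (1 + P * X \<omega> / se2)) 0 \<le> \<rho> \<longleftrightarrow> log 2 A - \<rho> \<le> log 2 (1 + P * X \<omega> / se2)"
          using 2 by auto
        also have "\<dots> \<longleftrightarrow> 2 powr (log 2 A - \<rho>) \<le> 1 + P * X \<omega> / se2"
          using arg[of \<omega>] by (intro le_log_iff) auto
        also have "2 powr (log 2 A - \<rho>) = A * 2 powr (- \<rho>)"
          using A by (simp add: powr_diff powr_minus divide_inverse)
        also have "A * 2 powr (- \<rho>) \<le> 1 + P * X \<omega> / se2 \<longleftrightarrow> ?t \<le> X \<omega> / k"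
        proof -
          have "?t = (A * 2 powr (- \<rho>) - 1) * se2 / P / k"
            using assms k by (simp add: field_simps)
          then have "?t \<le> X \<omega> / k \<longleftrightarrow> (A * 2 powr (- \<rho>) - 1) * se2 / P \<le> X \<omega>"
            using k by (simp only: divide_le_cancel) simp
          then show ?thesis
            using assms by (simp add: field_simps)
        qed
        finally show ?thesis .
      qed
      then have "cdf (distr M borel Rs) \<rho> = measure ?\<mu> {?t..}"
        unfolding cdf by (subst measure_distr) (auto intro!: arg_cong[where f = prob])
      also have "\<dots> = 1 - measure ?\<mu> {..<?t}"
        by (subst \<mu>.prob_compl[symmetric]) (auto intro!: arg_cong[where f = "measure ?\<mu>"])
      \<comment> \<open>The complement of the event is an open half-line, while \<open>cdf\<close>
        measures the closed one; the endpoint has mass 0.\<close>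
      also have "measure ?\<mu> {..<?t} = measure ?\<mu> {..<?t} + measure ?\<mu> {?t}"
        by (simp add: is_stable_no_atom[OF stable])
      also have "\<dots> = measure ?\<mu> ({..<?t} \<union> {?t})"
        by (intro \<mu>.finite_measure_Union[symmetric]) auto
      also have "{..<?t} \<union> {?t} = {..?t}" by auto
      finally show ?thesis
        using 2 by (simp add: cdf_def stable_measure_eq[OF stable])
    next
      case 3
      \<comment> \<open>The eavesdroppers can only reduce the rate, so it never exceeds the
        legitimate capacity \<open>log 2 A\<close>.\<close>
      have "0 \<le> log 2 (1 + P * X \<omega> / se2)" for \<omega>
        using arg[of \<omega>] by simp
      then have "max (log 2 A - log 2 (1 + P * X \<omega> / se2)) 0 \<le> \<rho>" for \<omega>
        using 3 by (smt (verit))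
      then have "{\<omega> \<in> space M. max (log 2 A - log 2 (1 + P * X \<omega> / se2)) 0 \<le> \<rho>} = space M" by blast
      then show ?thesis using 3 by (simp only: cdf) (simp add: prob_space)
    qed
  qed
  then show ?thesis
    using Rs unfolding cap A_def k_def by blast
qed

end
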